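(* Let $(\mathcal{L}_n)_{n\ge 0}$ be a Lucas-type sequence with data $p_0,p_1,d,g,\alpha$, and let $(\mathcal{F}_n)_{n\ge0}$ be the equivalent Fibonacci-type sequence, i.e. the one determined by the same $d$ and $g$ (as defined in the context). Let $\beta=\mathrm{lc}(d)$, $\eta=\deg(d)$, $\omega=\deg(g)$, $\rho=\mathrm{Res}(g,d)$. Then for all positive integers $n,m$, $$\mathrm{Res}(\mathcal{L}_n,\mathcal{F}_m)=\begin{cases}0 & \text{if }E_2(n)<E_2(m),\\ 2^{\eta\gcd(m,n)-\eta}\,\alpha^{\eta(1-m)}\left((-1)^{\eta\omega}\beta^{2\eta-\omega}\rho\right)^{n(m-1)/2} & \text{if }E_2(n)\ge E_2(m).\end{cases}$$
   Context: A Lucas-type sequence is given by a constant $p_0$ with $|p_0|\in\{1,2\}$, the integer $\alpha=2/p_0$, and non-zero polynomials $p_1,d,g\in\mathbb{Q}[x]$ with $d=\alpha p_1$, via $\mathcal{L}_0=p_0$, $\mathcal{L}_1=p_1$, $\mathcal{L}_n=d\,\mathcal{L}_{n-1}+g\,\mathcal{L}_{n-2}$ for $n\ge 2$. The equivalent Fibonacci-type sequence is $\mathcal{F}_0=0$, $\mathcal{F}_1=1$, $\mathcal{F}_n=d\,\mathcal{F}_{n-1}+g\,\mathcal{F}_{n-2}$ for $n\ge 2$. Standing assumptions: $\gcd(d,g)=1$, $\deg(g)<\deg(d)$, $\gcd(p_0,p_1)=\gcd(p_0,d)=\gcd(p_0,g)=1$, and $\deg(\mathcal{L}_1)\ge 1$.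 For a positive integer $n$, $E_2(n)$ is the largest integer $k$ with $2^k\mid n$ (the 2-adic valuation). $\mathrm{lc}(P)$ and $\deg(P)$ denote the leading coefficient and degree of $P$. For non-zero $P,Q\in\mathbb{Q}[x]$ of degrees $n,m$ with leading coefficients $a_n,b_m$ and complex roots $x_1,\dots,x_n$ and $y_1,\dots,y_m$ (with multiplicity), $\mathrm{Res}(P,Q)$ is the determinant of the Sylvester matrix of $P,Q$; equivalently $\mathrm{Res}(P,Q)=a_n^m b_m^n\prod_{i,j}(x_i-y_j)=a_n^m\prod_i Q(x_i)$. In particular $\mathrm{Res}(k,f)=\mathrm{Res}(f,k)=k^{\deg f}$ for a non-zero constant $k$. *)

theory Defs
  imports "Subresultants.Resultant_Prelim"
begin

fun lucas_poly :: "rat \<Rightarrow> rat poly \<Rightarrow> rat poly \<Rightarrow> rat poly \<Rightarrow> nat \<Rightarrow> rat poly" where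
  "lucas_poly p0 p1 d g 0 = [:p0:]"
| "lucas_poly p0 p1 d g (Suc 0) = p1"
| "lucas_poly p0 p1 d g (Suc (Suc n)) =
     d * lucas_poly p0 p1 d g (Suc n) + g * lucas_poly p0 p1 d g n"

fun fib_poly :: "rat poly \<Rightarrow> rat poly \<Rightarrow> nat \<Rightarrow> rat poly" where
  "fib_poly d g 0 = 0"
| "fib_poly d g (Suc 0) = 1"
| "fib_poly d g (Suc (Suc n)) = d * fib_poly d g (Suc n) + g * fib_poly d g n"

text \<open>
  The condition \<open>\<bar>p0\<bar> \<in> {1, 2}\<close> makes \<open>\<alpha> = 2 / p0\<close> an integer. The coprimality conditions are
  over the field of rationals, so the three involving the non-zero constant \<open>p0\<close> hold
  automatically.
\<close>

locale lucas_type =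
  fixes p0 :: rat and p1 d g :: "rat poly" and \<alpha> :: rat
  assumes p0: "\<bar>p0\<bar> \<in> {1, 2}"
    and alpha: "\<alpha> = 2 / p0"
    and p1_nz: "p1 \<noteq> 0" and d_nz: "d \<noteq> 0" and g_nz: "g \<noteq> 0"
    and d_eq: "d = smult \<alpha> p1"
    and coprime_d_g: "coprime d g"
    and deg_g_less: "degree g < degree d"
    and coprime_p0_p1: "coprime [:p0:] p1"
    and coprime_p0_d: "coprime [:p0:] d"
    and coprime_p0_g: "coprime [:p0:] g"
    and deg_L1: "degree (lucas_poly p0 p1 d g 1) \<ge> 1"

abbreviation E2 :: "nat \<Rightarrow> nat" where
  "E2 n \<equiv> multiplicity 2 n"

end

theory Submission
  imports Defs "Subresultants.Subresultant"
    "HOL-Computational_Algebra.Fundamental_Theorem_Algebra"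
begin

text \<open>
  Both sequences have a Euclidean algorithm on indices. Write \<open>L\<close> for the Lucas sequence normalised by
  \<open>L 0 = 2\<close>, \<open>L 1 = d\<close>. From \<open>F (k + 2r) = L (k + r) * F r + (-g)^r * F k\<close> and its relatives, modulo \<open>L n\<close>
  one may replace \<open>F m\<close> by a power of \<open>\<plusminus>g\<close> times \<open>F \<bar>m - 2n\<bar>\<close>, and modulo \<open>F m\<close> one may replace \<open>L n\<close>
  by a power of \<open>-g\<close> times \<open>L \<bar>n - 2m\<bar>\<close>. Each replacement keeps \<open>gcd m n\<close> and the parity of
  \<open>m div gcd m n\<close>, and multiplies the resultant by an explicit factor, since \<open>F (j + 1)\<close> and \<open>L j\<close> are
  congruent to \<open>d^j\<close> modulo \<open>g\<close>. The process stops at \<open>n = 0\<close>, at \<open>m = 0\<close> or at \<open>n = m\<close>, where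
  \<open>L n\<close> is \<open>2 * F (n + 1)\<close> modulo \<open>F n\<close>. Resultants are reduced modulo the first argument by a step of
  the Euclidean algorithm; their multiplicativity comes from the product formula over complex roots.
\<close>

subsection \<open>Resultants\<close>

lemma degree_mod_le_self:
  fixes f g :: "'a :: field poly"
  shows "degree (f mod g) \<le> degree f"
proof (cases "degree f < degree g")
  case True
  then show ?thesis by (simp add: mod_poly_less)
next
  case False
  then show ?thesis
    using degree_mod_less[of g f] by (cases "g = 0") auto
qed

text \<open>The subresultant of index 0 is the resultant, so one Euclidean step on subresultants
  gives the formula for \<open>resultant F G\<close>; swapping the arguments on the left then
  cancels the sign \<open>(-1) ^ (degree F * degree G)\<close>.\<close>

lemma resultant_mod:
  fixes F G :: "'a :: field poly"
  assumes G: "G \<noteq> 0" and deg: "degree G \<le> degree F"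
  shows "resultant G F = lead_coeff G ^ (degree F - degree (F mod G)) * resultant G (F mod G)"
proof (cases "degree G = 0")
  case True
  then obtain c where "G = [:c:]" by (rule degree_eq_zeroE)
  moreover have "F mod G = 0"
    using degree_mod_less[OF G, of F] True by simp
  ultimately show ?thesis by simp
next
  case False
  let ?H = "F mod G"
  have eq: "F + (- (F div G)) * G = ?H"
    by (simp add: minus_div_mult_eq_mod[symmetric])
  have choice: "degree G > degree ?H \<or> ?H = 0 \<and> F \<noteq> 0 \<and> G \<noteq> 0"
    using False degree_mod_less[OF G, of F] assms by auto
  have less: "degree ?H < degree G" using choice False by auto
  have "resultant F G = (- 1) ^ (degree F * degree G) *
      (lead_coeff G ^ (degree F - degree ?H) * resultant G ?H)"
  \<comment> \<open>Index 0 either equals the degree of the remainder or lies below it. In the first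
    case the subresultant is a multiple of the constant \<open>h\<close>, and
    \<open>h ^ (degree G - 1) * h\<close> is \<open>resultant G [:h:]\<close>; this covers
    \<open>h = 0\<close> as well.\<close>
  proof (cases "degree ?H = 0")
    case True
    then obtain h where h: "?H = [:h:]" by (rule degree_eq_zeroE)
    have "subresultant 0 F G = smult ((-1)^(degree F * degree G) *
        lead_coeff G ^ degree F * h ^ (degree G - 1)) [:h:]"
      using BT_lemma_1_13[OF eq deg choice] less unfolding h by simp
    moreover have "h ^ (degree G - 1) * h = h ^ degree G"
      using False by (metis power_minus_mult neq0_conv)
    ultimately show ?thesis using True h
      by (simp add: subresultant_resultant mult.assoc)
  next
    case False
    have "subresultant 0 F G = smult ((-1)^(degree F * degree G) *
        lead_coeff G ^ (degree F - degree ?H)) (subresultant 0 G ?H)"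
      using BT_lemma_1_12[OF eq deg choice, of 0] False by simp
    then show ?thesis by (simp add: subresultant_resultant mult.assoc)
  qed
  then show ?thesis
    by (simp add: resultant_swap[of G F] mult.assoc[symmetric] mult.commute[of "degree G"]
        power_mult_distrib[symmetric])
qed

text \<open>Both polynomials leave the same remainder modulo \<open>G\<close>; comparing the two
  reductions leaves a power of the leading coefficient that accounts for the drop in degree.\<close>

lemma resultant_cong:
  fixes F G H :: "'a :: field poly"
  assumes G: "G \<noteq> 0" and dvd: "G dvd F - H" and deg: "degree H \<le> degree F"
  shows "resultant G F = lead_coeff G ^ (degree F - degree H) * resultant G H"
proof -
  have mod: "F mod G = H mod G" using dvd by (simp add: mod_eq_dvd_iff)
  have H: "degree (H mod G) \<le> degree H"
    by (rule degree_mod_le_self)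
  consider "degree F < degree G" | "degree G \<le> degree F" "degree H < degree G"
    | "degree G \<le> degree H" using deg by linarith
  then show ?thesis
  proof cases
    case 1
    then have "F = H" using deg mod by (simp add: mod_poly_less)
    then show ?thesis by simp
  next
    case 2
    then show ?thesis using resultant_mod[OF G, of F] mod by (simp add: mod_poly_less)
  next
    case 3
    have "resultant G F = lead_coeff G ^ (degree F - degree (H mod G)) * resultant G (H mod G)"
      using resultant_mod[OF G, of F] mod 3 deg by simp
    also have "degree F - degree (H mod G) = (degree F - degree H) + (degree H - degree (H mod G))"
      using H deg by simp
    finally show ?thesis using resultant_mod[OF G 3] by (simp add: power_add mult.assoc)
  qed
qed

section \<open>Product formula over complex roots, and multiplicativity\<close>

definition root_resultant :: "complex poly \<Rightarrow> complex poly \<Rightarrow> complex" where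
  "root_resultant f g = lead_coeff f ^ degree g * (\<Prod>a\<in>#proots f. poly g a)"

lemma poly_eq_prod_proots:
  "poly g a = lead_coeff g * (\<Prod>b\<in>#proots g. (a - b))" for a :: complex
proof -
  have "poly g a = poly (smult (lead_coeff g) (\<Prod>x\<in>#proots g. [:-x, 1:])) a"
    by (simp only: complex_poly_decompose_multiset)
  then show ?thesis by (simp add: poly_prod_mset image_mset.compositionality o_def)
qed

text \<open>Both sides expand to the product of \<open>a - b\<close> over all pairs of roots, up to
  the sign of each factor.\<close>

lemma root_resultant_swap:
  "root_resultant f g = (- 1) ^ (degree f * degree g) * root_resultant g f"
proof -
  have expand: "root_resultant f g = lead_coeff f ^ degree g * lead_coeff g ^ degree f *
      (\<Prod>a\<in>#proots f. \<Prod>b\<in>#proots g. (a - b))" for f g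
    by (simp add: root_resultant_def poly_eq_prod_proots[of g] prod_mset.distrib size_proots_complex)
  have "(\<Prod>a\<in>#proots f. \<Prod>b\<in>#proots g. (a - b)) = (\<Prod>a\<in>#proots f. \<Prod>b\<in>#proots g. (-1) * (b - a))"
    by (simp only: mult_minus1 minus_diff_eq)
  also have "\<dots> = (-1) ^ (degree f * degree g) * (\<Prod>b\<in>#proots g. \<Prod>a\<in>#proots f. (b - a))"
    by (subst prod_mset.swap)
      (simp add: prod_mset.distrib size_proots_complex power_mult del: mult_minus1 mult_minus_left)
  finally show ?thesis by (simp add: expand)
qed

text \<open>Euclidean induction: both sides obey the same swap rule and the same reduction modulo
  \<open>f\<close>, because the values of \<open>g\<close> at the roots of \<open>f\<close> depend
  only on \<open>g mod f\<close>.\<close>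

lemma resultant_eq_root_resultant:
  assumes "f \<noteq> 0" "g \<noteq> 0"
  shows "resultant f g = root_resultant f g"
  using assms
proof (induction "degree f" arbitrary: f g rule: less_induct)
  case less
  show ?case
  proof (cases "degree f = 0")
    case True
    then obtain c where "f = [:c:]" by (rule degree_eq_zeroE)
    then show ?thesis by (simp add: root_resultant_def)
  next
    case False
    define r where "r = g mod f"
    have gr: "f dvd g - r" by (simp add: r_def)
    have deg: "degree r \<le> degree g"
      unfolding r_def by (rule degree_mod_le_self)
    have res: "resultant f g = lead_coeff f ^ (degree g - degree r) * resultant f r"
      using resultant_cong[OF less.prems(1) gr deg] .
    have eval: "poly g a = poly r a" if "poly f a = 0" for a
      using gr that by (auto simp: dvd_def algebra_simps elim!: dvdE)
    have eval': "(\<Prod>a\<in>#proots f. poly g a) = (\<Prod>a\<in>#proots f. poly r a)"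
      using less.prems by (intro arg_cong[of _ _ prod_mset] image_mset_cong) (simp add: eval)
    show ?thesis
    proof (cases "r = 0")
      case True
      obtain a where "a \<in># proots f"
        using False size_proots_complex[of f] by (metis multiset_nonemptyE size_empty)
      then have "(\<Prod>a\<in>#proots f. poly g a) = 0"
        unfolding eval' True by (auto simp: prod_mset_zero_iff)
      then show ?thesis using res True False by (simp add: root_resultant_def)
    next
      case r: False
      have "degree r < degree f"
        using degree_mod_less[OF less.prems(1), of g] r unfolding r_def by blast
      then have "resultant r f = root_resultant r f" using less r by blast
      then have "resultant f r = root_resultant f r"
        by (simp add: resultant_swap[of f r] root_resultant_swap[of f r])
      then show ?thesis
        using res deg by (simp add: root_resultant_def eval' power_add[symmetric])
    qed
  qed
qed

text \<open>The root product is visibly multiplicative in its second argument; the embedding of the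
  rationals into the complex numbers commutes with resultants and is injective.\<close>

lemma resultant_mult_right:
  fixes f g h :: "rat poly"
  assumes "f \<noteq> 0" "g \<noteq> 0" "h \<noteq> 0"
  shows "resultant f (g * h) = resultant f g * resultant f h"
proof -
  let ?c = "map_poly (of_rat :: rat \<Rightarrow> complex)"
  interpret c: map_poly_inj_comm_ring_hom "of_rat :: rat \<Rightarrow> complex" ..
  have "(of_rat (resultant f (g * h)) :: complex) = resultant (?c f) (?c g * ?c h)"
    by (simp add: of_rat_hom.resultant_hom[symmetric] c.hom_mult)
  also have "\<dots> = resultant (?c f) (?c g) * resultant (?c f) (?c h)"
    using assms by (simp add: resultant_eq_root_resultant root_resultant_def degree_mult_eq
        power_add prod_mset.distrib)
  also have "\<dots> = of_rat (resultant f g * resultant f h)"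
    by (simp add: of_rat_hom.resultant_hom of_rat_mult)
  finally show ?thesis by simp
qed

lemma resultant_power_right:
  fixes f g :: "rat poly"
  assumes "f \<noteq> 0" "g \<noteq> 0"
  shows "resultant f (g ^ n) = resultant f g ^ n"
  using assms by (induction n) (simp_all add: resultant_mult_right)

subsection \<open>Identities for the two sequences\<close>

text \<open>Cassini's identity with \<open>F (n + 2)\<close> expanded by the recurrence. In this
  form it eliminates \<open>(- g) ^ r\<close> in favour of two consecutive terms, after which ring
  normalisation finishes the proofs below.\<close>

lemma fib_poly_cassini:
  "fib_poly d g (Suc n) ^ 2 - d * fib_poly d g n * fib_poly d g (Suc n) - g * fib_poly d g n ^ 2
    = (- g) ^ n"
proof (induction n)
  case (Suc n)
  show ?case
    unfolding fib_poly.simps power_Suc Suc[symmetric] by (simp add: power2_eq_square algebra_simps)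
qed simp

abbreviation std_lucas_poly :: "rat poly \<Rightarrow> rat poly \<Rightarrow> nat \<Rightarrow> rat poly" where
  "std_lucas_poly d g \<equiv> lucas_poly 2 d d g"

lemma std_lucas_poly_Suc:
  "std_lucas_poly d g (Suc n) = d * fib_poly d g (Suc n) + 2 * g * fib_poly d g n"
  by (induction n rule: induct_nat_012) (simp_all add: numeral_poly algebra_simps)

lemma std_lucas_poly_eq:
  "std_lucas_poly d g n = 2 * fib_poly d g (Suc n) - d * fib_poly d g n"
proof (cases n)
  case (Suc k)
  then show ?thesis by (simp only: std_lucas_poly_Suc fib_poly.simps) (simp add: algebra_simps)
qed (simp add: numeral_poly)

text \<open>The recurrence is linear, so scaling the initial values scales the whole
  sequence.\<close>

lemma lucas_poly_eq_smult:
  assumes "p0 = 2 / \<alpha>" "d = smult \<alpha> p1" "\<alpha> \<noteq> 0"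
  shows "lucas_poly p0 p1 d g n = smult (1 / \<alpha>) (std_lucas_poly d g n)"
  using assms(3)
  by (induction n rule: induct_nat_012) (simp_all add: assms(1,2) smult_add_right)

text \<open>The two formulas are proved together because the induction step for each uses
  both.\<close>

lemma fib_poly_double:
  "fib_poly d g (2 * n) = std_lucas_poly d g n * fib_poly d g n \<and>
   fib_poly d g (Suc (2 * n)) = fib_poly d g (Suc n) ^ 2 + g * fib_poly d g n ^ 2"
proof (induction n)
  case (Suc n)
  have two: "2 * Suc n = Suc (Suc (2 * n))" by simp
  show ?case
    unfolding two fib_poly.simps(3) std_lucas_poly_eq
      Suc.IH[unfolded std_lucas_poly_eq, THEN conjunct1] Suc.IH[THEN conjunct2]
    by (intro conjI) (simp_all add: power2_eq_square algebra_simps)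
qed simp

lemma fib_poly_even: "fib_poly d g (2 * n) = std_lucas_poly d g n * fib_poly d g n"
  and fib_poly_odd: "fib_poly d g (Suc (2 * n)) = fib_poly d g (Suc n) ^ 2 + g * fib_poly d g n ^ 2"
  using fib_poly_double by blast+

text \<open>For fixed \<open>r\<close> both sides satisfy the same recurrence in \<open>k\<close>,
  so only \<open>k = 0\<close> and \<open>k = 1\<close> need checking. This version serves
  \<open>n = k + r\<close>, the next one \<open>n = r\<close>.\<close>

lemma fib_poly_add_twice:
  "fib_poly d g (k + 2 * r) =
     std_lucas_poly d g (k + r) * fib_poly d g r + (- g) ^ r * fib_poly d g k"
proof (induction k rule: induct_nat_012)
  case 0
  then show ?case by (simp add: fib_poly_even)
next
  case 1
  show ?case
    unfolding add_Suc add_0 fib_poly_odd fib_poly.simps fib_poly_cassini[of d g r, symmetric]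
      std_lucas_poly_Suc
    by (simp add: power2_eq_square algebra_simps)
next
  case (ge2 k)
  then show ?case by (simp add: algebra_simps)
qed

lemma fib_poly_add_twice':
  "fib_poly d g (k + 2 * r) =
     std_lucas_poly d g r * fib_poly d g (k + r) - (- g) ^ r * fib_poly d g k"
proof (induction k rule: induct_nat_012)
  case 0
  then show ?case by (simp add: fib_poly_even)
next
  case 1
  show ?case
    unfolding add_Suc add_0 fib_poly_odd fib_poly.simps fib_poly_cassini[of d g r, symmetric]
      std_lucas_poly_eq
    by (simp add: power2_eq_square algebra_simps)
next
  case (ge2 k)
  show ?case
    unfolding add_Suc fib_poly.simps ge2.IH(1) ge2.IH(2)[unfolded add_Suc]
    by (simp add: algebra_simps)
qed

text \<open>The factor \<open>d ^ 2 + 4 * g\<close> is the discriminant of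
  \<open>X^2 - d X - g\<close>. Since both \<open>F (k + r)\<close> and \<open>F r\<close> divide
  the first summand, one identity serves \<open>m = r\<close> and \<open>m = k + r\<close>
  alike.\<close>

lemma std_lucas_poly_add_twice:
  "std_lucas_poly d g (k + 2 * r) =
     (d ^ 2 + 4 * g) * fib_poly d g (k + r) * fib_poly d g r + (- g) ^ r * std_lucas_poly d g k"
proof (induction k rule: induct_nat_012)
  case 0
  show ?case
    unfolding add_0 std_lucas_poly_eq fib_poly_odd fib_poly_even
      fib_poly_cassini[of d g r, symmetric] fib_poly.simps
    by (simp add: power2_eq_square algebra_simps)
next
  case 1
  show ?case
    unfolding add_Suc add_0 std_lucas_poly_Suc fib_poly_odd fib_poly_even
      fib_poly_cassini[of d g r, symmetric] fib_poly.simps std_lucas_poly_eq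
    by (simp add: power2_eq_square algebra_simps)
next
  case (ge2 k)
  then show ?case by (simp add: algebra_simps)
qed

subsection \<open>Parity of the quotient by the gcd\<close>

text \<open>Dividing by the gcd lowers both valuations equally, and the coprime quotients are not
  both even.\<close>

lemma multiplicity_less_iff_even_div_gcd:
  fixes m n :: nat
  assumes "m > 0" "n > 0"
  shows "multiplicity 2 n < multiplicity 2 m \<longleftrightarrow> even (m div gcd m n)"
proof -
  define q where "q = gcd m n"
  obtain a b where ab: "m = q * a" "n = q * b"
    unfolding q_def by (meson dvdE gcd_dvd1 gcd_dvd2)
  have pos: "q > 0" "a > 0" "b > 0" using assms ab by auto
  have cop: "coprime a b" using ab pos unfolding q_def
    by (metis gcd_mult_left coprime_iff_gcd_eq_1 mult_cancel1 mult.right_neutral normalize_nat_def id_apply neq0_conv)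
  have "multiplicity 2 m = multiplicity 2 q + multiplicity 2 a"
    "multiplicity 2 n = multiplicity 2 q + multiplicity 2 b"
    unfolding ab using pos by (simp_all add: prime_elem_multiplicity_mult_distrib)
  moreover have "multiplicity 2 a > 0 \<longleftrightarrow> even a" "multiplicity 2 b > 0 \<longleftrightarrow> even b"
    using pos by (simp_all add: prime_multiplicity_gt_zero_iff)
  moreover have "\<not> (even a \<and> even b)" using cop by auto
  moreover have "m div q = a" using ab pos by simp
  ultimately show ?thesis unfolding q_def[symmetric] by auto
qed

text \<open>In the non-vanishing case this makes \<open>n * (m - 1)\<close> even, so halving it is
  exact, and it makes the signs of the reduction steps disappear.\<close>

lemma even_if_odd_div_gcd:
  fixes m n :: nat
  assumes "odd (m div gcd m n)" "even m"
  shows "even n"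
proof (rule ccontr)
  assume "odd n"
  then have "odd (gcd m n)" by (metis dvd_trans gcd_dvd2)
  moreover have "m = gcd m n * (m div gcd m n)" by simp
  ultimately show False using assms by (metis even_mult_iff)
qed

text \<open>Here \<open>k + 2 * r\<close> is \<open>k + 2 * n\<close> or \<open>2 * n - k\<close>.
  The gcd divides \<open>r\<close>, so the quotient changes by an even number.\<close>

lemma gcd_add_twice:
  fixes k n r :: nat
  assumes "n = r \<or> n = k + r"
  shows "gcd (k + 2 * r) n = gcd k n"
    and "odd ((k + 2 * r) div gcd k n) \<longleftrightarrow> odd (k div gcd k n)"
proof -
  have "c dvd k + 2 * r \<and> c dvd n \<longleftrightarrow> c dvd k \<and> c dvd n" for c
    using assms by (smt (verit) add.assoc dvd_add dvd_add_right_iff mult_2 dvd_add_left_iff)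
  then show "gcd (k + 2 * r) n = gcd k n"
    by (metis gcd_dvd1 gcd_dvd2 gcd_greatest dvd_antisym)
  have "gcd k n dvd r"
    using assms by (metis dvd_add_right_iff gcd_dvd1 gcd_dvd2)
  moreover have "gcd k n dvd k" by simp
  ultimately show "odd ((k + 2 * r) div gcd k n) \<longleftrightarrow> odd (k div gcd k n)"
    by (metis div_plus_div_distrib_dvd_left div_mult_swap even_add even_mult_iff even_numeral)
qed

subsection \<open>The resultant\<close>

locale fib_lucas =
  fixes d g :: "rat poly"
  assumes g_nz: "g \<noteq> 0" and deg_less: "degree g < degree d"
begin

abbreviation F where "F \<equiv> fib_poly d g"
abbreviation L where "L \<equiv> std_lucas_poly d g"

text \<open>Up to sign, the contribution of one factor \<open>g\<close> in a reduction, per unit of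
  \<open>j\<close> when the first argument has degree \<open>degree d * j\<close>: the power of
  \<open>lead_coeff d\<close> pays for the degree drop, the rest comes from the resultant with
  \<open>g\<close>.\<close>

definition K where
  "K = (- 1) ^ (degree d * degree g) * lead_coeff d ^ (2 * degree d - degree g) * resultant g d"

lemma d_nz: "d \<noteq> 0"
  using deg_less by auto

section \<open>Degrees and leading coefficients\<close>

lemma degree_lead_coeff_fib_Suc:
  "degree (F (Suc m)) = degree d * m \<and> lead_coeff (F (Suc m)) = lead_coeff d ^ m"
proof (induction m rule: induct_nat_012)
  case (ge2 m)
  have nz: "F (Suc (Suc m)) \<noteq> 0" "F (Suc m) \<noteq> 0"
    using ge2 d_nz by (metis leading_coeff_0_iff power_not_zero)+
  have deg: "degree (d * F (Suc (Suc m))) = degree d * Suc (Suc m)"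
    using ge2 nz d_nz by (simp add: degree_mult_eq)
  have less: "degree (g * F (Suc m)) < degree (d * F (Suc (Suc m)))"
    unfolding deg using ge2 nz g_nz deg_less by (simp add: degree_mult_eq)
  have eq: "F (Suc (Suc (Suc m))) = g * F (Suc m) + d * F (Suc (Suc m))" by simp
  have "degree (F (Suc (Suc (Suc m)))) = degree d * Suc (Suc m)"
    unfolding eq using degree_add_eq_right[OF less] deg by simp
  moreover have "lead_coeff (F (Suc (Suc (Suc m)))) = lead_coeff d * lead_coeff (F (Suc (Suc m)))"
    unfolding eq using lead_coeff_add_le[OF less] lead_coeff_mult by metis
  ultimately show ?case using ge2.IH(2) by (metis power_Suc)
qed (simp_all)

text \<open>At \<open>m = 0\<close> the truncated \<open>m - 1\<close> agrees with degree 0 of the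
  zero polynomial.\<close>

lemma degree_fib: "degree (F m) = degree d * (m - 1)"
  using degree_lead_coeff_fib_Suc[of "m - 1"] by (cases m) auto

lemma lead_coeff_fib: "m > 0 \<Longrightarrow> lead_coeff (F m) = lead_coeff d ^ (m - 1)"
  using degree_lead_coeff_fib_Suc[of "m - 1"] by (cases m) auto

lemma fib_nz: "m > 0 \<Longrightarrow> F m \<noteq> 0"
  using lead_coeff_fib[of m] d_nz by auto

lemma degree_lead_coeff_lucas_Suc:
  "degree (L (Suc n)) = degree d * Suc n \<and> lead_coeff (L (Suc n)) = lead_coeff d ^ Suc n"
proof -
  have deg: "degree (d * F (Suc n)) = degree d * Suc n"
    using fib_nz[of "Suc n"] d_nz by (simp add: degree_mult_eq degree_fib)
  have less: "degree (2 * g * F n) < degree (d * F (Suc n))"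
  proof (cases n)
    case 0
    then show ?thesis using deg_less by simp
  next
    case (Suc k)
    have "degree (2 * g * F n) = degree g + degree d * k"
      using fib_nz[of n] g_nz Suc by (simp add: degree_mult_eq degree_fib)
    then show ?thesis unfolding deg using deg_less Suc by simp
  qed
  have eq: "L (Suc n) = 2 * g * F n + d * F (Suc n)" by (simp add: std_lucas_poly_Suc)
  have "degree (L (Suc n)) = degree d * Suc n"
    unfolding eq using degree_add_eq_right[OF less] deg by simp
  moreover have "lead_coeff (L (Suc n)) = lead_coeff d * lead_coeff (F (Suc n))"
    unfolding eq using lead_coeff_add_le[OF less] lead_coeff_mult by metis
  ultimately show ?thesis using lead_coeff_fib[of "Suc n"] by simp
qed

lemma degree_lucas: "degree (L n) = degree d * n"
  using degree_lead_coeff_lucas_Suc[of "n - 1"] by (cases n) auto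

lemma lead_coeff_lucas: "n > 0 \<Longrightarrow> lead_coeff (L n) = lead_coeff d ^ n"
  using degree_lead_coeff_lucas_Suc[of "n - 1"] by (cases n) auto

lemma lucas_nz: "L n \<noteq> 0"
  using lead_coeff_lucas[of n] d_nz by (cases "n = 0") auto

section \<open>Both sequences modulo \<open>g\<close>, and their resultants with
  \<open>g\<close>\<close>

lemma fib_cong_power: "g dvd F (Suc m) - d ^ m"
proof (induction m rule: induct_nat_012)
  case (ge2 m)
  have "F (Suc (Suc (Suc m))) - d ^ Suc (Suc m) =
      d * (F (Suc (Suc m)) - d ^ Suc m) + g * F (Suc m)"
    by (simp add: algebra_simps)
  then show ?case using ge2 by (metis dvd_add dvd_mult dvd_triv_left)
qed auto

lemma lucas_cong_power: "g dvd L (Suc n) - d ^ Suc n"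
proof -
  have "L (Suc n) - d ^ Suc n = d * (F (Suc n) - d ^ n) + g * (2 * F n)"
    by (simp add: std_lucas_poly_Suc algebra_simps)
  then show ?thesis using fib_cong_power[of n] by (metis dvd_add dvd_mult dvd_triv_left)
qed

text \<open>\<open>F m\<close> and \<open>d ^ (m - 1)\<close> have the same degree, so replacing one
  by the other modulo \<open>g\<close> costs no power of the leading coefficient.\<close>

lemma resultant_fib_g:
  assumes "m > 0"
  shows "resultant (F m) g = ((- 1) ^ (degree d * degree g) * resultant g d) ^ (m - 1)"
proof -
  have "resultant g (F m) = resultant g d ^ (m - 1)"
    using resultant_cong[OF g_nz, of "F m" "d ^ (m - 1)"] fib_cong_power[of "m - 1"] assms g_nz d_nz
    by (simp add: degree_fib degree_power_eq resultant_power_right)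
  then show ?thesis
    by (subst resultant_swap) (simp add: degree_fib power_mult_distrib power_mult[symmetric] mult_ac)
qed

lemma resultant_lucas_g:
  assumes "n > 0"
  shows "resultant (L n) g = ((- 1) ^ (degree d * degree g) * resultant g d) ^ n"
proof -
  have "resultant g (L n) = resultant g d ^ n"
    using resultant_cong[OF g_nz, of "L n" "d ^ n"] lucas_cong_power[of "n - 1"] assms g_nz d_nz
    by (simp add: degree_lucas degree_power_eq resultant_power_right)
  then show ?thesis
    by (subst resultant_swap) (simp add: degree_lucas power_mult_distrib power_mult[symmetric] mult_ac)
qed

text \<open>This is applied to \<open>P = F (j + 1)\<close> and to \<open>P = L j\<close>.\<close>

lemma resultant_step:
  assumes P: "degree P = degree d * j" "lead_coeff P = lead_coeff d ^ j"
      "resultant P g = ((- 1) ^ (degree d * degree g) * resultant g d) ^ j"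
    and dvd: "P dvd A - smult s ((- g) ^ r * B)"
    and deg: "degree A = degree B + degree d * (2 * r)"
    and nz: "B \<noteq> 0" "s \<noteq> 0"
  shows "resultant P A = s ^ (degree d * j) * (- 1) ^ (degree d * j * r) * K ^ (j * r) * resultant P B"
proof -
  let ?H = "smult s ((- g) ^ r * B)"
  have P0: "P \<noteq> 0" using P(2) d_nz by auto
  have degH: "degree ?H = degree g * r + degree B"
    using nz g_nz by (simp add: degree_mult_eq degree_power_eq)
  have le: "degree g * r \<le> degree d * (2 * r)"
    using mult_le_mono1[of "degree g" "2 * degree d" r] deg_less by (simp add: mult_ac)
  have "resultant P ?H = s ^ (degree d * j) * resultant P ((- g) ^ r) * resultant P B"
    using nz g_nz P0 by (simp add: resultant_smult_right P resultant_mult_right)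
  also have "resultant P ((- g) ^ r) = ((- 1) ^ (degree d * j) * resultant P g) ^ r"
    using resultant_smult_right[of "-1" P g] P0 g_nz P by (simp add: resultant_power_right)
  finally have H: "resultant P ?H = s ^ (degree d * j) * ((- 1) ^ (degree d * j) * resultant P g) ^ r
      * resultant P B" .
  have "resultant P A = lead_coeff P ^ (degree d * (2 * r) - degree g * r) * resultant P ?H"
    using resultant_cong[OF P0 dvd] degH le deg by simp
  also have "degree d * (2 * r) - degree g * r = (2 * degree d - degree g) * r"
    by (simp add: diff_mult_distrib2 mult_ac)
  finally show ?thesis
    unfolding H P(2,3) K_def by (simp add: power_mult_distrib power_mult[symmetric] mult_ac)
qed

lemma resultant_fib_step:
  assumes "m > 0" "F m dvd A - smult s ((- g) ^ r * B)"
    "degree A = degree B + degree d * (2 * r)" "B \<noteq> 0" "s \<noteq> 0"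
  shows "resultant (F m) A = s ^ (degree d * (m - 1)) * (- 1) ^ (degree d * (m - 1) * r) *
    K ^ ((m - 1) * r) * resultant (F m) B"
  by (rule resultant_step[OF degree_fib lead_coeff_fib[OF assms(1)] resultant_fib_g[OF assms(1)]
        assms(2-5)])

lemma resultant_lucas_step:
  assumes "n > 0" "L n dvd A - smult s ((- g) ^ r * B)"
    "degree A = degree B + degree d * (2 * r)" "B \<noteq> 0" "s \<noteq> 0"
  shows "resultant (L n) A = s ^ (degree d * n) * (- 1) ^ (degree d * n * r) *
    K ^ (n * r) * resultant (L n) B"
  by (rule resultant_step[OF degree_lucas lead_coeff_lucas[OF assms(1)] resultant_lucas_g[OF assms(1)]
        assms(2-5)])

section \<open>Reduction steps on the pair of indices\<close>

lemma resultant_lucas_fib_swap: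
  "resultant (L n) (F m) = (- 1) ^ (degree d * (n * (m - 1))) * resultant (F m) (L n)"
  by (subst resultant_swap) (auto simp: degree_lucas degree_fib minus_one_power_iff)

text \<open>For \<open>n = r\<close> the congruence carries \<open>s = -1\<close>, whose extra sign
  \<open>(- 1) ^ (degree d * n)\<close> turns \<open>r\<close> into \<open>Suc r\<close> in the
  exponent.\<close>

lemma resultant_lucas_fib_reduce_fib:
  assumes "k > 0" "n > 0" "n = r \<or> n = k + r"
  shows "resultant (L n) (F (k + 2 * r)) =
    (- 1) ^ (degree d * (n * (if n = r then Suc r else r))) * K ^ (n * r) * resultant (L n) (F k)"
proof (cases "n = r")
  case True
  have "L n dvd F (k + 2 * r) - smult (- 1) ((- g) ^ r * F k)"
    by (simp add: fib_poly_add_twice' True)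
  from resultant_lucas_step[OF assms(2) this] assms True show ?thesis
    by (simp add: degree_fib fib_nz power_add[symmetric] algebra_simps diff_mult_distrib2)
next
  case False
  have "L n dvd F (k + 2 * r) - smult 1 ((- g) ^ r * F k)"
    using assms False by (simp add: fib_poly_add_twice)
  from resultant_lucas_step[OF assms(2) this] assms False show ?thesis
    by (simp add: degree_fib fib_nz algebra_simps diff_mult_distrib2)
qed

lemma resultant_lucas_fib_reduce_lucas:
  assumes "m > 0" "m = r \<or> m = k + r"
  shows "resultant (L (k + 2 * r)) (F m) =
    (- 1) ^ (degree d * ((m - 1) * r)) * K ^ ((m - 1) * r) * resultant (L k) (F m)"
proof -
  have "F m dvd L (k + 2 * r) - smult 1 ((- g) ^ r * L k)"
    using assms by (auto simp: std_lucas_poly_add_twice)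
  from resultant_fib_step[OF assms(1) this]
  have "resultant (F m) (L (k + 2 * r)) =
      (- 1) ^ (degree d * ((m - 1) * r)) * K ^ ((m - 1) * r) * resultant (F m) (L k)"
    by (simp add: degree_lucas lucas_nz algebra_simps)
  \<comment> \<open>The signs of the two swaps cancel, since \<open>k + 2 * r\<close> and
    \<open>k\<close> have the same parity.\<close>
  then show ?thesis
    by (simp add: resultant_lucas_fib_swap) (simp add: minus_one_power_iff)
qed

text \<open>Descent along the recurrence, with \<open>s = -1\<close> and \<open>r = 1\<close>, whose
  two signs cancel. The exponents of \<open>K\<close> add up to a triangular number.\<close>

lemma resultant_fib_consecutive:
  "resultant (F (Suc n)) (F (Suc (Suc n))) = K ^ (Suc n * n div 2)"
proof (induction n)
  case (Suc n)
  have "F (Suc (Suc n)) dvd F (Suc (Suc (Suc n))) - smult (- 1) ((- g) ^ 1 * F (Suc n))"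
    by simp
  from resultant_fib_step[OF _ this]
  have "resultant (F (Suc (Suc n))) (F (Suc (Suc (Suc n)))) =
      K ^ Suc n * resultant (F (Suc (Suc n))) (F (Suc n))"
    using fib_nz[of "Suc n"]
    by (simp add: degree_fib power_mult_distrib[symmetric] del: fib_poly.simps(3))
  also have "resultant (F (Suc (Suc n))) (F (Suc n)) = K ^ (Suc n * n div 2)"
    by (subst resultant_swap) (auto simp: degree_fib Suc.IH minus_one_power_iff simp del: fib_poly.simps(3))
  also have "K ^ Suc n * K ^ (Suc n * n div 2) = K ^ (Suc n + Suc n * n div 2)"
    by (rule power_add[symmetric])
  also have "Suc n + Suc n * n div 2 = Suc (Suc n) * Suc n div 2"
  proof -
    have "Suc (Suc n) * Suc n = Suc n * n + Suc n * 2" by simp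
    then show ?thesis by simp
  qed
  finally show ?case .
qed simp

text \<open>Modulo \<open>F n\<close>, \<open>L n\<close> is \<open>2 * F (Suc n)\<close>, of the
  same degree; the swap sign is trivial as \<open>n * (n - 1)\<close> is even.\<close>

lemma resultant_lucas_fib_same:
  assumes "n > 0"
  shows "resultant (L n) (F n) = 2 ^ (degree d * (n - 1)) * K ^ (n * (n - 1) div 2)"
proof -
  have "F n dvd L n - smult 2 (F (Suc n))"
    by (simp add: std_lucas_poly_eq numeral_poly)
  from resultant_cong[OF fib_nz[OF assms] this]
  have "resultant (F n) (L n) = 2 ^ (degree d * (n - 1)) * resultant (F n) (F (Suc n))"
    by (simp add: degree_lucas degree_fib resultant_smult_right)
  then show ?thesis
    using resultant_fib_consecutive[of "n - 1"] assms
    by (simp add: resultant_lucas_fib_swap minus_one_power_iff)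
qed

lemma resultant_lucas_fib:
  assumes "n > 0 \<or> m > 0"
  shows "resultant (L n) (F m) =
    (if odd (m div gcd m n) then 2 ^ (degree d * (gcd m n - 1)) * K ^ (n * (m - 1) div 2) else 0)"
    (is "_ = ?rhs n m")
  using assms
proof (induction "n + m" arbitrary: n m rule: less_induct)
  case less
  \<comment> \<open>In the last two cases \<open>k\<close> is the distance of the larger index from
    twice the smaller. \<open>m = 2 * n\<close> stands apart because a step with
    \<open>k = 0\<close> would need \<open>F 0\<close> to be nonzero; in \<open>lucas\<close>,
    \<open>k = 0\<close> is harmless as \<open>L 0 = 2\<close>.\<close>
  consider (zero) "n = 0" "m > 0" | (zero') "n > 0" "m = 0" | (same) "n > 0" "n = m"
    | (double) "n > 0" "m = 2 * n"
    | (fib) k r where "k > 0" "r > 0" "n > 0" "m = k + 2 * r" "n = r \<or> n = k + r"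
    | (lucas) k r where "r > 0" "m > 0" "n = k + 2 * r" "m = r \<or> m = k + r"
  proof -
    consider "n = 0" | "m = 0" | "n = m" | "m = 2 * n" | "0 < n" "n < m" "m < 2 * n"
      | "n > 0" "2 * n < m" | "m > 0" "m < n" "n < 2 * m" | "m > 0" "2 * m \<le> n" by linarith
    then show thesis
    proof cases
      case 1 then show thesis using less.prems zero by blast
    next
      case 2 then show thesis using less.prems zero' by blast
    next
      case 3 then show thesis using less.prems same by blast
    next
      case 4 then show thesis using less.prems double by simp
    next
      case 5 then show thesis using fib[of "2 * n - m" "m - n"] by auto
    next
      case 6 then show thesis using fib[of "m - 2 * n" n] by auto
    next
      case 7 then show thesis using lucas[of "n - m" "2 * m - n"] by auto
    next
      case 8 then show thesis using lucas[of m "n - 2 * m"] by auto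
    qed
  qed
  then show ?case
  proof cases
    case zero
    then show ?thesis by (simp add: numeral_poly degree_fib)
  next
    case zero'
    then show ?thesis using deg_less by (simp add: degree_lucas)
  next
    case same
    then show ?thesis by (simp add: resultant_lucas_fib_same)
  next
    case double
    then have "L n dvd F m - 0" by (simp add: fib_poly_even)
    from resultant_cong[OF lucas_nz this] have "resultant (L n) (F m) = 0"
      using double deg_less by (simp add: degree_lucas)
    then show ?thesis using double by simp
  next
    case fib
    have IH: "resultant (L n) (F k) = ?rhs n k"
      using less.hyps[of n k] fib by simp
    have gcd: "gcd m n = gcd k n" and odd: "odd (m div gcd k n) \<longleftrightarrow> odd (k div gcd k n)"
      using gcd_add_twice fib by blast+
    have "n * (m - 1) = n * (k - 1) + (n * r) * 2"
      using fib by (cases k) (auto simp: algebra_simps)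
    then have ex: "n * (m - 1) div 2 = n * r + n * (k - 1) div 2" by simp
    \<comment> \<open>If \<open>n = r\<close>, the exponent contains \<open>r * (r + 1)\<close>.
      Otherwise \<open>m\<close> even forces \<open>n\<close> even, while \<open>m\<close> odd makes
      \<open>k\<close> odd, so \<open>(k + r) * r\<close> is even.\<close>
    have sign: "even (n * (if n = r then Suc r else r))" if "odd (m div gcd m n)"
    proof (cases "n = r")
      case False
      have "even n" if "even m" using even_if_odd_div_gcd that \<open>odd (m div gcd m n)\<close> by blast
      then show ?thesis using False fib by auto
    qed auto
    have "resultant (L n) (F m) = (- 1) ^ (degree d * (n * (if n = r then Suc r else r))) *
        K ^ (n * r) * ?rhs n k"
      using resultant_lucas_fib_reduce_fib[of k n r] fib IH by simp
    then show ?thesis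
      using sign unfolding gcd odd ex by (auto simp: power_add minus_one_power_iff)
  next
    case lucas
    have IH: "resultant (L k) (F m) = ?rhs k m"
      using less.hyps[of k m] lucas by simp
    have gcd: "gcd m n = gcd m k"
      using gcd_add_twice(1)[of m r k] lucas by (simp add: gcd.commute)
    have "n * (m - 1) = k * (m - 1) + ((m - 1) * r) * 2"
      unfolding lucas(3) add_mult_distrib by (simp only: mult_ac)
    then have ex: "n * (m - 1) div 2 = (m - 1) * r + k * (m - 1) div 2" by simp
    \<comment> \<open>If \<open>m\<close> is even, then so is \<open>n\<close>, hence
      \<open>k\<close>, hence \<open>r\<close>.\<close>
    have sign: "even ((m - 1) * r)" if "odd (m div gcd m n)"
    proof -
      have "even n" if "even m" using even_if_odd_div_gcd that \<open>odd (m div gcd m n)\<close> by blast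
      then show ?thesis using lucas by auto
    qed
    have "resultant (L n) (F m) = (- 1) ^ (degree d * ((m - 1) * r)) *
        K ^ ((m - 1) * r) * ?rhs k m"
      using resultant_lucas_fib_reduce_lucas[of m r k] lucas IH by simp
    then show ?thesis
      using sign unfolding gcd ex by (auto simp: power_add minus_one_power_iff)
  qed
qed

end

theorem theorem3:
  fixes p0 \<alpha> \<beta> \<rho> :: rat and p1 d g :: "rat poly" and \<eta> \<omega> n m :: nat
  assumes "lucas_type p0 p1 d g \<alpha>"
    and "\<beta> = lead_coeff d" and "\<eta> = degree d" and "\<omega> = degree g"
    and "\<rho> = resultant g d"
    and "n > 0" and "m > 0"
  shows "resultant (lucas_poly p0 p1 d g n) (fib_poly d g m) =
    (if E2 n < E2 m then 0
     else 2 ^ (\<eta> * gcd m n - \<eta>) * \<alpha> powi (int \<eta> * (1 - int m)) *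
       ((- 1) ^ (\<eta> * \<omega>) * \<beta> ^ (2 * \<eta> - \<omega>) * \<rho>) ^ (n * (m - 1) div 2))"
proof -
  interpret lucas_type p0 p1 d g \<alpha> by fact
  interpret fib_lucas d g by unfold_locales (fact g_nz deg_g_less)+
  have nz: "p0 \<noteq> 0" using p0 by auto
  have \<alpha>: "\<alpha> \<noteq> 0" "p0 = 2 / \<alpha>" using nz alpha by simp_all
  \<comment> \<open>The exponent is minus the degree of \<open>F m\<close>: pulling the scalar
    \<open>1 / \<alpha>\<close> out of the first argument raises it to that degree.\<close>
  have "int \<eta> * (1 - int m) = - int (\<eta> * (m - 1))"
    using \<open>m > 0\<close> by (simp add: of_nat_diff algebra_simps)
  then have pow: "\<alpha> powi (int \<eta> * (1 - int m)) = (1 / \<alpha>) ^ (\<eta> * (m - 1))"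
    by (simp add: power_int_minus power_int_of_nat power_one_over inverse_eq_divide del: of_nat_mult)
  have two: "\<eta> * gcd m n - \<eta> = \<eta> * (gcd m n - 1)"
    by (simp add: diff_mult_distrib2)
  have K: "K = (- 1) ^ (\<eta> * \<omega>) * \<beta> ^ (2 * \<eta> - \<omega>) * \<rho>"
    unfolding K_def assms(2-5) ..
  have "resultant (lucas_poly p0 p1 d g n) (F m) = (1 / \<alpha>) ^ (\<eta> * (m - 1)) * resultant (L n) (F m)"
    unfolding lucas_poly_eq_smult[OF \<alpha>(2) d_eq \<alpha>(1)]
    using \<alpha>(1) assms(3) by (simp add: resultant_smult_left degree_fib)
  then show ?thesis
    unfolding pow two K[symmetric] multiplicity_less_iff_even_div_gcd[OF assms(7,6)]
    using assms(3,6) by (simp add: resultant_lucas_fib)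
qed

end
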